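(* For a real sequence $a=\{a_k\}_{k=1}^\infty$, not identically zero, set $\|a\|^2=\sum_{k=1}^\infty a_k^2$, $\|a\|_1^2=\sum_{k=1}^\infty(k-1/2)^2a_k^2$, $\|a\|_2^2=\sum_{k=1}^\infty(k-1/2)^4a_k^2$. Then $$\Bigl(\sum_{k=1}^\infty a_k\Bigr)^2\le\pi\|a\|\,\|a\|_1\bigl(1-2e^{-2\pi\|a\|_1/\|a\|}\bigr)$$ whenever $\|a\|_1<\infty$, where all constants are sharp and no extremals exist (equality never holds). Moreover, $$\Bigl(\sum_{k=1}^\infty a_k\Bigr)^2\le\frac{\sqrt2\,\pi}{\sqrt[4]{27}}\coth(\pi/2)\,\|a\|^{3/2}\|a\|_2^{1/2}$$ whenever $\|a\|_2<\infty$, and this inequality becomes an equality for the sequence $a_k=\frac1{(2k-1)^4+4}$, which is the unique extremal up to multiplication by a nonzero constant. *)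

theory Defs
  imports Complex_Main
begin

text \<open>Sequences a = (a_k)_{k>=1} are represented as functions nat => real;
  the value at index 0 is ignored.\<close>

definition nonzero_seq :: "(nat \<Rightarrow> real) \<Rightarrow> bool" where
  "nonzero_seq a \<longleftrightarrow> (\<exists>k\<ge>1. a k \<noteq> 0)"

definition seq_sum :: "(nat \<Rightarrow> real) \<Rightarrow> real" where
  "seq_sum a = (\<Sum>k. a (Suc k))"

definition norm0 :: "(nat \<Rightarrow> real) \<Rightarrow> real" where
  "norm0 a = sqrt (\<Sum>k. (a (Suc k))^2)"

definition norm1 :: "(nat \<Rightarrow> real) \<Rightarrow> real" where
  "norm1 a = sqrt (\<Sum>k. (real (Suc k) - 1/2)^2 * (a (Suc k))^2)"

definition norm2 :: "(nat \<Rightarrow> real) \<Rightarrow> real" where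
  "norm2 a = sqrt (\<Sum>k. (real (Suc k) - 1/2)^4 * (a (Suc k))^2)"

definition fin_norm1 :: "(nat \<Rightarrow> real) \<Rightarrow> bool" where
  "fin_norm1 a \<longleftrightarrow> summable (\<lambda>k. (real (Suc k) - 1/2)^2 * (a (Suc k))^2)"

definition fin_norm2 :: "(nat \<Rightarrow> real) \<Rightarrow> bool" where
  "fin_norm2 a \<longleftrightarrow> summable (\<lambda>k. (real (Suc k) - 1/2)^4 * (a (Suc k))^2)"

definition coth :: "real \<Rightarrow> real" where
  "coth x = cosh x / sinh x"

definition extremal_seq :: "nat \<Rightarrow> real" where
  "extremal_seq k = 1 / ((2 * real k - 1)^4 + 4)"

end

theory Submission
  imports Defs "HOL-Analysis.Gamma_Function" "HOL-Real_Asymp.Real_Asymp"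
begin

text \<open>
  Write $x_k = k - 1/2$. Cauchy--Schwarz with the weights $x_k^2 + r^2$ bounds the square of the
  sum by $\frac{\pi}{2r}\tanh(\pi r)\,(r^2\|a\|^2 + \|a\|_1^2)$ for every $r > 0$. With
  $t = \|a\|_1/\|a\| \ge 1/2$, the choice $r = t$ is not quite good enough, but
  $r = t(1 - t e^{-2\pi t})$ is. Equality for a given $r$ holds for $a_k = 1/(x_k^2 + r^2)$; letting
  $r$ tend to infinity, where $t - r$ tends to 0, shows that no constant can be improved.
  The weights $x_k^4 + 4s^4$ give the second inequality: the sum of their inverses is
  $\frac{\pi}{8s^3}H(2\pi s)$ with $H(y) = (\sinh y - \sin y)/(\cosh y + \cos y)$, whose
  maximum over $y > 0$ is attained only at $y = \pi$, that is for $s = 1/2$.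
  Both sums of inverse weights come from the partial fractions of the tangent.
\<close>

section \<open>Partial fractions of the tangent and the sums of inverse weights\<close>

text \<open>Differentiate both sides of the reflection formula
  \<open>rGamma z * rGamma (1 - z) = sin (pi * z) / pi\<close> and compare the results.\<close>

lemma Digamma_reflection_complex:
  fixes z :: complex
  assumes "z \<notin> \<int>"
  shows "sin (of_real pi * z) * (Digamma (1 - z) - Digamma z) = of_real pi * cos (of_real pi * z)"
proof -
  have z: "z \<notin> \<int>\<^sub>\<le>\<^sub>0" "1 - z \<notin> \<int>\<^sub>\<le>\<^sub>0"
    using assms nonpos_Ints_Int by (blast, metis Ints_1 Ints_diff diff_diff_eq2 add_diff_cancel_left' nonpos_Ints_Int)
  have "((\<lambda>z. rGamma z * rGamma (1 - z)) has_field_derivative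
      rGamma z * rGamma (1 - z) * (Digamma (1 - z) - Digamma z)) (at z)"
    using z by (auto intro!: derivative_eq_intros simp: algebra_simps)
  moreover have "((\<lambda>z. rGamma z * rGamma (1 - z)) has_field_derivative cos (of_real pi * z)) (at z)"
    unfolding rGamma_reflection_complex by (auto intro!: derivative_eq_intros)
  ultimately have "rGamma z * rGamma (1 - z) * (Digamma (1 - z) - Digamma z) = cos (of_real pi * z)"
    by (rule DERIV_unique)
  then show ?thesis by (simp add: rGamma_reflection_complex field_simps)
qed

text \<open>Subtracting the Digamma series at \<open>z = w + 1/2\<close> and at \<open>1 - z\<close>
  cancels the harmonic terms and Euler's constant. The shift by a half turns the cotangent of the
  reflection formula into a tangent.\<close>

lemma tan_partial_fractions:
  fixes w :: complex
  assumes "w + 1/2 \<notin> \<int>"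
  shows "(\<lambda>k. 2 * w / ((of_nat k + 1/2)^2 - w^2)) sums (of_real pi * tan (of_real pi * w))"
proof -
  define z where "z = w + 1/2"
  have zI: "z \<notin> \<int>" using assms z_def by simp
  have z: "z \<notin> \<int>\<^sub>\<le>\<^sub>0" "1 - z \<notin> \<int>\<^sub>\<le>\<^sub>0"
    using zI nonpos_Ints_Int by (blast, metis Ints_1 Ints_diff diff_diff_eq2 add_diff_cancel_left' nonpos_Ints_Int)
  have s: "(\<lambda>k. inverse (of_nat (Suc k)) - inverse (y + of_nat k)) sums (Digamma y + euler_mascheroni)"
    if "y \<notin> \<int>\<^sub>\<le>\<^sub>0" for y :: complex
  proof -
    have "y \<noteq> 0" using that by auto
    from summable_sums[OF summable_Digamma[OF this]] show ?thesis by (simp add: Digamma_def)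
  qed
  have "(\<lambda>k. inverse (1 - z + of_nat k) - inverse (z + of_nat k)) sums (Digamma z - Digamma (1 - z))"
    using sums_diff[OF s[OF z(1)] s[OF z(2)]] by simp
  moreover have "inverse (1 - z + of_nat k) - inverse (z + of_nat k) = 2 * w / ((of_nat k + 1/2)^2 - w^2)" for k
  proof -
    have "of_nat k + 1/2 - w \<noteq> 0"
    proof
      assume "of_nat k + 1/2 - w = 0"
      hence "w + 1/2 = of_nat (Suc k)" by (simp add: field_simps)
      thus False using assms by (metis Ints_of_nat)
    qed
    moreover have "of_nat k + 1/2 + w \<noteq> 0"
    proof
      assume "of_nat k + 1/2 + w = 0"
      hence "w + 1/2 = - of_nat k" by (simp add: eq_neg_iff_add_eq_0 add_ac)
      thus False using assms by (metis Ints_of_nat Ints_minus)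
    qed
    ultimately have "inverse (of_nat k + 1/2 - w) - inverse (of_nat k + 1/2 + w)
       = 2 * w / ((of_nat k + 1/2 - w) * (of_nat k + 1/2 + w))"
      by (simp add: divide_simps)
    thus ?thesis by (simp add: z_def power2_eq_square algebra_simps)
  qed
  moreover have "Digamma z - Digamma (1 - z) = of_real pi * tan (of_real pi * w)"
  proof -
    have e: "sin (of_real pi * z) = cos (of_real pi * w)" "cos (of_real pi * z) = - sin (of_real pi * w)"
      unfolding z_def using sin_add[of "of_real pi * w" "of_real pi / 2"] cos_add[of "of_real pi * w" "of_real pi / 2"]
      by (simp_all add: distrib_left del: sin_add cos_add)
    have "sin (of_real pi * z) \<noteq> 0"
      using zI by (auto simp: sin_eq_0 mult.commute[of z])
    then show ?thesis using Digamma_reflection_complex[OF zI] e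
      by (simp add: tan_def field_simps)
  qed
  ultimately show ?thesis by simp
qed

text \<open>At \<open>w = \<i> * r\<close> the partial fractions have denominators
  \<open>(k + 1/2)^2 + r^2\<close>, and both sides are \<open>\<i>\<close> times a real number
  because tan(iy) = i tanh(y).\<close>

lemma sums_inverse_quadratic:
  fixes r :: real
  assumes "r > 0"
  shows "(\<lambda>k. 1 / ((real k + 1/2)^2 + r^2)) sums (pi * tanh (pi * r) / (2 * r))"
proof -
  have "\<i> * of_real r + 1/2 \<notin> \<int>"
    using assms by (auto elim!: Ints_cases simp: complex_eq_iff)
  note tan_partial_fractions[OF this]
  moreover have "tanh (of_real pi * of_real r :: complex) = of_real (tanh (pi * r))"
    by (simp add: tanh_def sinh_field_def cosh_field_def flip: exp_of_real)
  ultimately have "(\<lambda>k. of_real (2 * r / ((real k + 1/2)^2 + r^2)) * \<i>) sums (of_real (pi * tanh (pi * r)) * \<i>)"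
    by (simp add: tan_conv_tanh power_mult_distrib mult_ac)
  from sums_Im[OF this] have "(\<lambda>k. 2 * r / ((real k + 1/2)^2 + r^2)) sums (pi * tanh (pi * r))"
    by simp
  from sums_divide[OF this, of "2 * r"] show ?thesis using assms by simp
qed

lemma cosh_plus_cos_pos:
  fixes y :: real
  assumes "y > 0"
  shows "cosh y + cos y > 0"
proof -
  have "cosh y > 1" using cosh_real_nonneg_less_iff[of 0 y] assms by simp
  with cos_ge_minus_one[of y] show ?thesis by linarith
qed

lemma Complex_divide_of_real: "Complex x y / of_real h = Complex (x / h) (y / h)"
  by (simp add: complex_eq_iff)

text \<open>At \<open>w = s + \<i> * s\<close> the square \<open>w^2\<close> is purely imaginary,
  equal to \<open>2 * \<i> * s^2\<close>. The imaginary part of \<open>1 / (x^2 - w^2)\<close> is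
  then \<open>2 * s^2 / (x^4 + 4 * s^4)\<close>.\<close>

lemma sums_inverse_quartic:
  fixes s :: real
  assumes "s > 0"
  shows "(\<lambda>k. 1 / ((real k + 1/2)^4 + 4 * s^4)) sums
    (pi / (8 * s^3) * ((sinh (2 * pi * s) - sin (2 * pi * s)) / (cosh (2 * pi * s) + cos (2 * pi * s))))"
proof -
  define w where "w = Complex s s"
  define a where "a = pi * s"
  have aw: "of_real pi * w = Complex a a" by (simp add: w_def a_def complex_eq_iff)
  have w2: "w^2 = Complex 0 (2 * s^2)" by (simp add: w_def power2_eq_square complex_eq_iff)
  have "w + 1/2 \<notin> \<int>"
    using assms by (auto elim!: Ints_cases simp: w_def complex_eq_iff)
  note sums_divide[OF tan_partial_fractions[OF this], of "2 * w"]
  moreover have "w \<noteq> 0" using assms by (simp add: w_def complex_eq_iff)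
  ultimately have "(\<lambda>k. 1 / ((of_nat k + 1/2)^2 - w^2)) sums (of_real pi * tan (of_real pi * w) / (2 * w))"
    by simp
  from sums_Im[OF this]
  have *: "(\<lambda>k. Im (1 / ((of_nat k + 1/2)^2 - w^2))) sums Im (of_real pi * tan (of_real pi * w) / (2 * w))" .
  have l: "Im (1 / ((of_nat k + 1/2)^2 - w^2)) = 2 * s^2 / ((real k + 1/2)^4 + 4 * s^4)" for k
  proof -
    have "(of_nat k + 1/2)^2 - w^2 = Complex ((real k + 1/2)^2) (- (2 * s^2))"
      by (simp only: w2) (simp add: complex_eq_iff power2_eq_square)
    thus ?thesis by (simp add: Im_divide power_mult_distrib flip: power_mult)
  qed
  have p: "cosh (2 * a) + cos (2 * a) > 0" using cosh_plus_cos_pos[of "2*a"] assms by (simp add: a_def)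
  have t: "tan (Complex a a) =
    Complex (sin (2 * a) / (cosh (2 * a) + cos (2 * a))) (sinh (2 * a) / (cosh (2 * a) + cos (2 * a)))"
  proof -
    have 1: "sin (Complex a a) = Complex (sin a * cosh a) (cos a * sinh a)"
      "cos (Complex a a) = Complex (cos a * cosh a) (- (sin a * sinh a))"
      by (simp_all add: complex_eq_iff Re_sin Im_sin Re_cos Im_cos sinh_field_def cosh_field_def field_simps)
    have sq: "cosh a ^ 2 = 1 + sinh a ^ 2" "sin a ^ 2 = 1 - cos a ^ 2"
      by (simp_all add: cosh_square_eq sin_squared_eq)
    have d: "cosh (2 * a) + cos (2 * a) = 2 * (sinh a ^ 2 + cos a ^ 2)"
      by (simp add: cosh_double cos_double sq)
    \<comment> \<open>The formula for the tangent is first checked in cross-multiplied form. It also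
      shows that the cosine is nonzero: otherwise the sine would vanish at the same point.\<close>
    have m: "sin (Complex a a) * of_real (cosh (2 * a) + cos (2 * a))
       = Complex (sin (2 * a)) (sinh (2 * a)) * cos (Complex a a)"
      unfolding 1 d sin_double sinh_double using sq
      by (simp add: complex_eq_iff) algebra
    have "cos (Complex a a) \<noteq> 0"
    proof
      assume c: "cos (Complex a a) = 0"
      with m p have "sin (Complex a a) = 0" by (auto simp del: of_real_add)
      with c show False using sin_cos_squared_add[of "Complex a a"] by simp
    qed
    with m p have "tan (Complex a a) = Complex (sin (2 * a)) (sinh (2 * a)) / of_real (cosh (2 * a) + cos (2 * a))"
      by (simp add: tan_def divide_simps mult.commute del: of_real_add)
    then show ?thesis by (simp only: Complex_divide_of_real)
  qed
  have "Im (of_real pi * Complex u v / (2 * w)) = pi / (4 * s) * (v - u)" for u v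
    using assms by (simp add: w_def Im_divide power2_eq_square field_simps)
  then have "Im (of_real pi * tan (of_real pi * w) / (2 * w)) =
    pi / (4 * s) * ((sinh (2 * a) - sin (2 * a)) / (cosh (2 * a) + cos (2 * a)))"
    unfolding aw t by (simp only: diff_divide_distrib)
  with * l have "(\<lambda>k. 2 * s^2 / ((real k + 1/2)^4 + 4 * s^4)) sums
     (pi / (4 * s) * ((sinh (2 * a) - sin (2 * a)) / (cosh (2 * a) + cos (2 * a))))" by simp
  from sums_divide[OF this, of "2 * s^2"]
  have "(\<lambda>k. 1 / ((real k + 1/2)^4 + 4 * s^4)) sums
     (pi / (4 * s) * ((sinh (2 * a) - sin (2 * a)) / (cosh (2 * a) + cos (2 * a))) / (2 * s^2))"
    using assms by simp
  moreover have "pi / (4 * s) * h / (2 * s^2) = pi / (8 * s^3) * h" for h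
    by (simp add: power2_eq_square power3_eq_cube)
  moreover have "2 * a = 2 * pi * s" by (simp add: a_def)
  ultimately show ?thesis by (simp only:)
qed

section \<open>Weighted Cauchy-Schwarz and convergence of the norms\<close>

text \<open>With \<open>c = suminf a / P\<close>, the nonnegative series of
  \<open>w k * (a k - c / w k)^2\<close> has sum \<open>Q - (suminf a)^2 / P\<close>. This gives the
  inequality, and in the case of equality every term vanishes.\<close>

lemma weighted_Cauchy_Schwarz_sums:
  fixes a w :: "nat \<Rightarrow> real"
  assumes w: "\<And>k. w k > 0" and P: "(\<lambda>k. 1 / w k) sums P" and Q: "(\<lambda>k. w k * (a k)^2) sums Q"
  shows "summable a"
    and "(suminf a)^2 \<le> P * Q"
    and "(suminf a)^2 = P * Q \<Longrightarrow> \<exists>c. \<forall>k. a k = c / w k"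
proof -
  show S: "summable a"
  proof (rule summable_comparison_test')
    show "summable (\<lambda>k. w k * (a k)^2 + 1 / w k)"
      using P Q by (intro summable_add) (auto simp: sums_iff)
    fix k :: nat
    \<comment> \<open>Expanded, this square bounds \<open>2 * \<bar>a k\<bar>\<close> by the terms
      of a convergent series.\<close>
    have "0 \<le> (w k * \<bar>a k\<bar> - 1)^2 / w k" using w[of k] by simp
    also have "\<dots> = w k * (a k)^2 + 1 / w k - 2 * \<bar>a k\<bar>"
      using w[of k] by (simp add: power2_eq_square field_simps)
    finally show "norm (a k) \<le> w k * (a k)^2 + 1 / w k" by simp
  qed
  define c where "c = suminf a / P"
  have "P > 0" using sums_unique[OF P] P w by (auto simp: sums_iff intro!: suminf_pos)
  define d where "d = (\<lambda>k. w k * (a k - c / w k)^2)"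
  have "(\<lambda>k. w k * (a k)^2 - 2 * c * a k + c^2 * (1 / w k)) sums (Q - 2 * c * suminf a + c^2 * P)"
    using S by (intro sums_add sums_diff sums_mult P Q summable_sums)
  moreover have "w k * (a k)^2 - 2 * c * a k + c^2 * (1 / w k) = d k" for k
    using w[of k] by (simp add: d_def power2_eq_square field_simps)
  moreover have "Q - 2 * c * suminf a + c^2 * P = Q - (suminf a)^2 / P"
    using \<open>P > 0\<close> by (simp add: c_def power2_eq_square field_simps)
  ultimately have d: "d sums (Q - (suminf a)^2 / P)" by simp
  have d0: "d k \<ge> 0" for k using w[of k] by (simp add: d_def)
  have "0 \<le> Q - (suminf a)^2 / P" using suminf_nonneg[of d] d d0 by (auto simp: sums_iff)
  then show "(suminf a)^2 \<le> P * Q" using \<open>P > 0\<close> by (simp add: field_simps)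
  assume "(suminf a)^2 = P * Q"
  with d \<open>P > 0\<close> have "d sums 0" by simp
  then have "d k = 0" for k using suminf_eq_zero_iff[of d] d0 by (auto simp: sums_iff)
  then show "\<exists>c. \<forall>k. a k = c / w k" using w unfolding d_def
    by (intro exI[of _ c]) (metis less_irrefl mult_eq_0_iff eq_iff_diff_eq_0 power2_eq_square)
qed

text \<open>The smallest weight is \<open>1/4\<close>, so convergence of the weighted series forces
  that of the unweighted one; the same comparison gives the lower bound 1/2 for the ratio of the
  norms.\<close>

lemma norms_if_fin_norm1:
  assumes "nonzero_seq a" "fin_norm1 a"
  shows "(\<lambda>k. (a (Suc k))^2) sums (norm0 a)^2"
    and "(\<lambda>k. (real k + 1/2)^2 * (a (Suc k))^2) sums (norm1 a)^2"
    and "norm0 a > 0"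
    and "norm0 a / 2 \<le> norm1 a"
proof -
  have s1: "summable (\<lambda>k. (real k + 1/2)^2 * (a (Suc k))^2)"
    using assms(2) by (simp add: fin_norm1_def add_ac)
  have le: "1/4 * (a (Suc k))^2 \<le> (real k + 1/2)^2 * (a (Suc k))^2" for k
    by (intro mult_right_mono) (auto simp: power2_eq_square field_simps)
  have s0: "summable (\<lambda>k. 1/4 * (a (Suc k))^2)"
    by (rule summable_comparison_test'[OF s1]) (use le in auto)
  then have s0': "summable (\<lambda>k. (a (Suc k))^2)" by simp
  obtain k where "k \<ge> 1" "a k \<noteq> 0" using assms by (auto simp: nonzero_seq_def)
  then obtain j where "a (Suc j) \<noteq> 0" by (cases k) auto
  then have p: "0 < (\<Sum>k. (a (Suc k))^2)" by (intro suminf_pos2[OF s0', of j]) auto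
  then show "norm0 a > 0" by (simp add: norm0_def)
  show n0: "(\<lambda>k. (a (Suc k))^2) sums (norm0 a)^2"
    using s0' p by (simp add: norm0_def sums_iff)
  have p1: "0 \<le> (\<Sum>k. (real k + 1/2)^2 * (a (Suc k))^2)" by (intro suminf_nonneg s1) auto
  then show n1: "(\<lambda>k. (real k + 1/2)^2 * (a (Suc k))^2) sums (norm1 a)^2"
    using s1 by (simp add: norm1_def sums_iff add_ac)
  have "1/4 * (norm0 a)^2 \<le> (norm1 a)^2"
    by (rule sums_le[OF le sums_mult[OF n0] n1])
  then have "(norm0 a / 2)^2 \<le> (norm1 a)^2" by (simp add: power_divide)
  moreover have "norm1 a \<ge> 0" using p1 by (simp add: norm1_def add_ac)
  ultimately show "norm0 a / 2 \<le> norm1 a" by (rule power2_le_imp_le)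
qed

lemma norms_if_fin_norm2:
  assumes "nonzero_seq a" "fin_norm2 a"
  shows "(\<lambda>k. (a (Suc k))^2) sums (norm0 a)^2"
    and "(\<lambda>k. (real k + 1/2)^4 * (a (Suc k))^2) sums (norm2 a)^2"
    and "norm0 a > 0" and "norm2 a > 0"
proof -
  have s2: "summable (\<lambda>k. (real k + 1/2)^4 * (a (Suc k))^2)"
    using assms(2) by (simp add: fin_norm2_def add_ac)
  have le: "1/16 * (a (Suc k))^2 \<le> (real k + 1/2)^4 * (a (Suc k))^2" for k
    using power_mono[of "1/2" "real k + 1/2" 4]
    by (intro mult_right_mono) (auto simp: power_divide)
  have s0: "summable (\<lambda>k. 1/16 * (a (Suc k))^2)"
    by (rule summable_comparison_test'[OF s2]) (use le in auto)
  then have s0': "summable (\<lambda>k. (a (Suc k))^2)" by simp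
  obtain k where "k \<ge> 1" "a k \<noteq> 0" using assms by (auto simp: nonzero_seq_def)
  then obtain j where j: "a (Suc j) \<noteq> 0" by (cases k) auto
  then have p: "0 < (\<Sum>k. (a (Suc k))^2)" by (intro suminf_pos2[OF s0', of j]) auto
  then show "norm0 a > 0" by (simp add: norm0_def)
  show "(\<lambda>k. (a (Suc k))^2) sums (norm0 a)^2"
    using s0' p by (simp add: norm0_def sums_iff)
  have p2: "0 < (\<Sum>k. (real k + 1/2)^4 * (a (Suc k))^2)"
    using j by (intro suminf_pos2[OF s2, of j]) auto
  then show "norm2 a > 0" by (simp add: norm2_def add_ac)
  show "(\<lambda>k. (real k + 1/2)^4 * (a (Suc k))^2) sums (norm2 a)^2"
    using s2 p2 by (simp add: norm2_def sums_iff add_ac)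
qed

section \<open>Extremal problems in one real variable\<close>

text \<open>The derivative of \<open>H\<close> has the sign of the sine, so \<open>H\<close>
  increases up to \<open>pi\<close> and decreases from there to \<open>2 * pi\<close>. Beyond that,
  a crude exponential bound suffices.\<close>

lemma quotient_sinh_sin_le_coth:
  fixes y :: real
  assumes "y > 0"
  defines "H \<equiv> \<lambda>y. (sinh y - sin y) / (cosh y + cos y)"
  shows "H y \<le> coth (pi / 2)" and "H y = coth (pi / 2) \<longleftrightarrow> y = pi"
proof -
  have deriv: "(H has_real_derivative 2 * sinh x * sin x / (cosh x + cos x)^2) (at x)" if "x > 0" for x
  proof -
    have "(cosh x - cos x) * (cosh x + cos x) - (sinh x - sin x) * (sinh x - sin x)
        = 2 * sinh x * sin x"
      using cosh_square_eq[of x] sin_squared_eq[of x] by (simp add: power2_eq_square algebra_simps)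
    then show ?thesis unfolding H_def using cosh_plus_cos_pos[OF that]
      by (auto intro!: derivative_eq_intros simp: power2_eq_square)
  qed
  have cont: "continuous_on {u..v} H" if "u > 0" for u v
    using that by (intro continuous_at_imp_continuous_on ballI DERIV_isCont[OF deriv]) auto
  have Hpi: "H pi = coth (pi / 2)"
  proof -
    have "sinh pi = 2 * sinh (pi/2) * cosh (pi/2)" using sinh_double[of "pi/2"] by simp
    moreover have "cosh pi - 1 = 2 * (sinh (pi/2))^2"
      using cosh_double[of "pi/2"] by (simp add: cosh_square_eq)
    moreover have "sinh (pi / 2) \<noteq> 0" by simp
    ultimately show ?thesis unfolding H_def coth_def
      by (simp add: power2_eq_square)
  qed
  have less: "H y < coth (pi / 2)" if ne: "y \<noteq> pi"
  proof -
    consider "y < pi" | "pi < y" "y < 2 * pi" | "y \<ge> 2 * pi" using ne by linarith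
    then show ?thesis
    proof cases
      case 1
      have "H y < H pi"
      proof (rule DERIV_pos_imp_increasing_open[OF 1])
        fix x assume x: "y < x" "x < pi"
        then have "x > 0" using assms by linarith
        with x have "0 < 2 * sinh x * sin x / (cosh x + cos x)^2"
          using cosh_plus_cos_pos[of x] by (auto intro!: divide_pos_pos mult_pos_pos sin_gt_zero)
        with deriv[OF \<open>x > 0\<close>] show "\<exists>l. (H has_real_derivative l) (at x) \<and> 0 < l" by blast
      qed (use cont assms in auto)
      then show ?thesis by (simp add: Hpi)
    next
      case 2
      have "H pi > H y"
      proof (rule DERIV_neg_imp_decreasing_open[OF 2(1)])
        fix x assume x: "pi < x" "x < y"
        then have "x > 0" using pi_gt_zero by linarith
        have "sin x < 0" using sin_lt_zero[of x] x 2 by auto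
        then have "2 * sinh x * sin x / (cosh x + cos x)^2 < 0"
          using cosh_plus_cos_pos[of x] \<open>x > 0\<close> by (intro divide_neg_pos mult_pos_neg) auto
        with deriv[OF \<open>x > 0\<close>] show "\<exists>l. (H has_real_derivative l) (at x) \<and> l < 0" by blast
      qed (use cont in auto)
      then show ?thesis by (simp add: Hpi)
    next
      case 3
      \<comment> \<open>Bounding sine and cosine below by -1 gives
        \<open>H y \<le> (v + 1) / (v - 1)\<close> with \<open>v = exp y / 2\<close>. This quotient
        decreases in \<open>v\<close>, its value at \<open>E\<close> is
        \<open>coth (pi / 2)\<close>, and here \<open>v > E\<close>.\<close>
      define E where "E = exp pi"
      have E: "E > 2" using exp_ge_add_one_self[of pi] pi_gt3 unfolding E_def by linarith
      have "E * E \<le> exp y" using 3 by (simp add: E_def flip: exp_add)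
      moreover have "2 * E < E * E" using E by simp
      ultimately have y: "2 * E < exp y" by linarith
      have "coth (pi / 2) = (E - 1 / E) / (E + 1 / E - 2)"
      proof -
        have "sinh pi = (E - 1 / E) / 2" "cosh pi + cos pi = (E + 1 / E - 2) / 2"
          by (simp_all add: E_def sinh_field_def cosh_field_def exp_minus inverse_eq_divide diff_divide_distrib add_divide_distrib)
        moreover have "(u / 2) / (v / 2) = u / v" for u v :: real by simp
        ultimately show ?thesis unfolding Hpi[symmetric] H_def by (simp only: sin_pi diff_zero)
      qed
      also have "\<dots> = (E + 1) / (E - 1)"
      proof -
        have "E + 1 / E - 2 = (E - 1) * (E - 1) / E" "E - 1 / E = (E + 1) * (E - 1) / E"
          using E by (auto simp: field_simps)
        then show ?thesis using E by simp
      qed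
      finally have K: "coth (pi / 2) = (E + 1) / (E - 1)" .
      define X \<sigma> \<kappa> where X: "X = exp (- y)" "\<sigma> = sin y" "\<kappa> = cos y"
      have "X > 0" "\<sigma> \<ge> -1" "\<kappa> \<ge> -1" by (simp_all add: X)
      moreover have "sinh y = (exp y - X) / 2" "cosh y = (exp y + X) / 2"
        by (simp_all add: X sinh_field_def cosh_field_def)
      ultimately have "sinh y - \<sigma> \<le> exp y / 2 + 1" "exp y / 2 - 1 \<le> cosh y + \<kappa>"
        by (simp_all add: field_simps)
      then have "H y \<le> (exp y / 2 + 1) / (exp y / 2 - 1)"
        unfolding H_def X using y E cosh_plus_cos_pos[OF assms(1)]
        by (intro frac_le) auto
      also have "\<dots> < (E + 1) / (E - 1)"
        using y E by (simp add: divide_simps) (simp add: algebra_simps)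
      finally show ?thesis using K by simp
    qed
  qed
  then show "H y \<le> coth (pi / 2)" "H y = coth (pi / 2) \<longleftrightarrow> y = pi"
    using Hpi by (cases "y = pi"; simp)+
qed

text \<open>This is the Cauchy-Schwarz bound divided by \<open>pi * norm0 a * norm1 a\<close>, with
  \<open>t\<close> the ratio of the norms. Lowering \<open>r\<close> below \<open>t\<close> changes
  the factor \<open>(r^2 + t^2) / (2 * r * t)\<close> only to second order, but \<open>tanh\<close>
  to first order.\<close>

lemma ex_tanh_mean_less:
  fixes t :: real
  assumes "t \<ge> 1/2"
  shows "\<exists>r>0. tanh (pi * r) * (r^2 + t^2) / (2 * r * t) < 1 - 2 * exp (- 2 * pi * t)"
proof -
  define e where "e = exp (- 2 * pi * t)"
  \<comment> \<open>The expression is minimal near \<^term>\<open>r = t * (1 - 4 * pi * t * e)\<close>; any multiple of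
    \<^term>\<open>t * e\<close> of that order gains more than the loss of order \<^term>\<open>e^2\<close> at \<^term>\<open>r = t\<close>.\<close>
  define x where "x = t * e"
  define r where "r = t * (1 - x)"
  define y where "y = 2 * pi * t * x"
  define D where "D = e * (1 + y)"
  have pt: "pi * t \<ge> 3 * t" "pi * t \<ge> 3 / 2" using pi_gt3 assms mult_mono[of 3 pi "1/2" t] by auto
  have "exp (2 * pi * t) \<ge> 1 + 2 * (pi * t)"
    using exp_ge_add_one_self[of "2 * pi * t"] by (simp add: mult.assoc)
  moreover have einv: "e = 1 / exp (2 * pi * t)" by (simp add: e_def exp_minus inverse_eq_divide)
  ultimately have "exp (2 * pi * t) \<ge> 4" "exp (2 * pi * t) \<ge> 6 * t" using pt by linarith+
  then have e: "0 < e" "e \<le> 1/4" and x: "0 < x" "x \<le> 1/6"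
    using assms unfolding x_def einv by (auto simp: field_simps)
  have r: "r > 0" using x assms by (simp add: r_def)
  have y0: "y > 0" using x assms by (simp add: y_def)
  have D0: "D > 0" using e y0 by (simp add: D_def)
  have "exp (- 2 * (pi * r)) = e * exp y"
    by (simp add: e_def y_def r_def algebra_simps flip: exp_add)
  then have E: "exp (- 2 * (pi * r)) \<ge> D"
    using exp_ge_add_one_self[of y] e by (simp add: D_def)
  have T: "tanh (pi * r) \<le> (1 - D) / (1 + D)"
    unfolding tanh_real_altdef using E D0 by (simp add: divide_simps) (simp add: algebra_simps)
  have m: "(r^2 + t^2) / (2 * r * t) = 1 + x^2 / (2 * (1 - x))"
    using assms x by (simp add: r_def power2_eq_square field_simps)
  have "x^2 / (2 * (1 - x)) \<le> x^2 / 1" using x by (intro divide_left_mono) auto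
  then have m': "(r^2 + t^2) / (2 * r * t) \<le> 1 + x^2" unfolding m by simp
  have t2: "t^2 \<ge> 1/4" using power_mono[OF assms, of 2] by (simp add: power2_eq_square)
  \<comment> \<open>After clearing denominators the goal is
    \<open>x^2 - x^2 * D < 2 * D - 2 * e - 2 * e * D\<close>, whose right-hand side equals
    \<open>2 * e^2 * (2 * q - 1)\<close>. Since \<open>q \<ge> 9/4 * t^2\<close> and
    \<open>t^2 \<ge> 1/4\<close>, it is at least \<open>t^2 * e^2 = x^2\<close>.\<close>
  define q where "q = pi * t^2 * (1 - e)"
  have "3 * t^2 * (3/4) \<le> q"
    unfolding q_def using pi_gt3 e by (intro mult_mono) auto
  then have "t^2 \<le> 2 * (2 * q - 1)" using t2 by simp
  then have "t^2 * e^2 \<le> 2 * (2 * q - 1) * e^2" by (intro mult_right_mono) auto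
  also have "\<dots> = 2 * D - 2 * e - 2 * e * D"
    by (simp add: D_def y_def x_def q_def power2_eq_square algebra_simps)
  finally have x2: "x^2 \<le> 2 * D - 2 * e - 2 * e * D" by (simp add: x_def power_mult_distrib)
  moreover have "x^2 * D > 0" using x D0 by simp
  ultimately have fin: "(1 + x^2) * (1 - D) < (1 - 2 * e) * (1 + D)" by (simp add: algebra_simps)
  have "tanh (pi * r) * ((r^2 + t^2) / (2 * r * t)) \<le> tanh (pi * r) * (1 + x^2)"
    using r m' by (intro mult_left_mono) auto
  also have "\<dots> \<le> (1 - D) / (1 + D) * (1 + x^2)" using T by (intro mult_right_mono) auto
  also have "\<dots> = (1 + x^2) * (1 - D) / (1 + D)" by (simp add: field_simps)
  also have "\<dots> < 1 - 2 * e" using fin D0 by (simp add: pos_divide_less_eq)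
  finally show ?thesis using r by (intro exI[of _ r]) (auto simp: e_def)
qed


section \<open>The first inequality\<close>

lemma seq_sum_le_norm1:
  assumes "nonzero_seq a" "fin_norm1 a" "r > 0"
  shows "(seq_sum a)^2 \<le> pi * tanh (pi * r) / (2 * r) * (r^2 * (norm0 a)^2 + (norm1 a)^2)"
proof -
  have "(\<lambda>k. ((real k + 1/2)^2 + r^2) * (a (Suc k))^2) sums (r^2 * (norm0 a)^2 + (norm1 a)^2)"
    using sums_add[OF sums_mult[OF norms_if_fin_norm1(1)[OF assms(1,2)], of "r^2"]
        norms_if_fin_norm1(2)[OF assms(1,2)]]
    by (simp add: algebra_simps)
  from weighted_Cauchy_Schwarz_sums(2)[OF _ sums_inverse_quadratic[OF assms(3)] this]
  show ?thesis unfolding seq_sum_def using assms(3) by (simp add: add_nonneg_pos)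
qed

text \<open>The strict sign comes from \<open>ex_tanh_mean_less\<close>, applied to the ratio of the
  two norms.\<close>

lemma seq_sum_less_norm1:
  assumes "nonzero_seq a" "fin_norm1 a"
  shows "(seq_sum a)^2 < pi * norm0 a * norm1 a * (1 - 2 * exp (- 2 * pi * norm1 a / norm0 a))"
proof -
  note n = norms_if_fin_norm1[OF assms]
  define t where "t = norm1 a / norm0 a"
  have t: "t \<ge> 1/2" using n(3,4) by (simp add: t_def field_simps)
  have n1: "norm1 a = t * norm0 a" using n(3) by (simp add: t_def)
  obtain r where r: "r > 0" "tanh (pi * r) * (r^2 + t^2) / (2 * r * t) < 1 - 2 * exp (- 2 * pi * t)"
    using ex_tanh_mean_less[OF t] by blast
  have "(seq_sum a)^2 \<le> pi * tanh (pi * r) / (2 * r) * (r^2 * (norm0 a)^2 + (norm1 a)^2)"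
    by (rule seq_sum_le_norm1[OF assms r(1)])
  also have "\<dots> = pi * norm0 a * norm1 a * (tanh (pi * r) * (r^2 + t^2) / (2 * r * t))"
    using t r(1) by (simp add: n1 power2_eq_square field_simps)
  also have "\<dots> < pi * norm0 a * norm1 a * (1 - 2 * exp (- 2 * pi * t))"
    using n(3) n1 t by (intro mult_strict_left_mono r(2)) auto
  finally show ?thesis by (simp add: t_def)
qed

section \<open>Sharpness of the constants in the first inequality\<close>

text \<open>These sequences are the reciprocals of the weights, the equality case of Cauchy-Schwarz.
  The last claim determines the ratio of the norms; as \<open>u\<close> decays exponentially in
  \<open>r\<close>, the ratio is extremely close to \<open>r\<close>.\<close>

lemma inverse_quadratic_seq:
  fixes r :: real
  assumes r: "r > 0"
  defines "a \<equiv> \<lambda>k. 1 / ((real k - 1/2)^2 + r^2)" and "u \<equiv> 2 * pi * r / sinh (2 * pi * r)"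
  shows "nonzero_seq a" and "fin_norm1 a"
    and "pi * tanh (pi * r) * norm0 a * norm1 a \<le> (seq_sum a)^2"
    and "u * (r^2 + (norm1 a / norm0 a)^2) = (norm1 a / norm0 a)^2 - r^2"
proof -
  define T where "T = pi * tanh (pi * r) / (2 * r)"
  have a: "a (Suc k) = 1 / ((real k + 1/2)^2 + r^2)" for k by (simp add: a_def add_ac)
  have sq: "(real k + 1/2)^2 + r^2 > 0" for k using r by (simp add: add_nonneg_pos)
  have s: "(\<lambda>k. a (Suc k)) sums T" using sums_inverse_quadratic[OF r] by (simp add: a T_def)
  show nz: "nonzero_seq a"
    using sq[of 0] by (auto simp: nonzero_seq_def a intro!: exI[of _ "Suc 0"])
  have "summable (\<lambda>k. (real k + 1/2)^2 * (a (Suc k))^2)"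
  proof (rule summable_comparison_test')
    show "summable (\<lambda>k. a (Suc k))" using s by (simp add: sums_iff)
    fix k :: nat
    have "(real k + 1/2)^2 * (a (Suc k))^2 \<le> ((real k + 1/2)^2 + r^2) * (a (Suc k))^2"
      by (intro mult_right_mono) auto
    also have "\<dots> = a (Suc k)" using sq[of k] by (simp add: a power2_eq_square)
    finally show "norm ((real k + 1/2)^2 * (a (Suc k))^2) \<le> a (Suc k)" by simp
  qed
  then show fin: "fin_norm1 a" by (simp add: fin_norm1_def add_ac)
  note n = norms_if_fin_norm1[OF nz fin]
  have S: "seq_sum a = T" using s by (simp add: seq_sum_def sums_iff)
  have "(\<lambda>k. r^2 * (a (Suc k))^2 + (real k + 1/2)^2 * (a (Suc k))^2) sums (r^2 * (norm0 a)^2 + (norm1 a)^2)"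
    by (intro sums_add sums_mult n)
  \<comment> \<open>Weight times \<open>a^2\<close> is \<open>a\<close> itself, so the weighted norm
    squared and the sum of the sequence are the same number \<open>T\<close>.\<close>
  moreover have "r^2 * (a (Suc k))^2 + (real k + 1/2)^2 * (a (Suc k))^2 = a (Suc k)" for k
    using sq[of k] by (simp add: a power2_eq_square flip: add_divide_distrib) (simp add: add_ac)
  ultimately have Q: "r^2 * (norm0 a)^2 + (norm1 a)^2 = T" using s by (auto intro: sums_unique2)
  have "0 \<le> (r * norm0 a - norm1 a)^2" by simp
  then have "2 * r * norm0 a * norm1 a \<le> T" unfolding Q[symmetric] by (simp add: power2_eq_square algebra_simps)
  then have "T * (2 * r * norm0 a * norm1 a) \<le> T * T"
    using r by (intro mult_left_mono) (auto simp: T_def)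
  then show "pi * tanh (pi * r) * norm0 a * norm1 a \<le> (seq_sum a)^2"
    using r by (simp add: S T_def power2_eq_square)
  define t where "t = norm1 a / norm0 a"
  \<comment> \<open>The upper bounds for all \<open>\<rho>\<close> are attained at \<^term>\<open>r\<close>, so their derivative in \<open>\<rho>\<close> vanishes
    there. This gives the ratio of the norms without evaluating the norms themselves.\<close>
  define f where "f = (\<lambda>\<rho>. tanh (pi * \<rho>) / \<rho> * (\<rho>^2 + t^2))"
  have n1: "norm1 a = t * norm0 a" using n(3) by (simp add: t_def)
  have f: "pi * tanh (pi * \<rho>) / (2 * \<rho>) * (\<rho>^2 * (norm0 a)^2 + (norm1 a)^2) = pi * (norm0 a)^2 / 2 * f \<rho>" for \<rho>
    by (simp add: f_def n1 power_mult_distrib algebra_simps)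
  have min: "f r \<le> f \<rho>" if "\<rho> > 0" for \<rho>
  proof -
    have "pi * (norm0 a)^2 / 2 * f r = (seq_sum a)^2"
      unfolding f[symmetric] Q S by (simp add: T_def power2_eq_square)
    also have "\<dots> \<le> pi * (norm0 a)^2 / 2 * f \<rho>"
      unfolding f[symmetric] by (rule seq_sum_le_norm1[OF nz fin that])
    finally show ?thesis using n(3) by simp
  qed
  define h where "h = tanh (pi * r)"
  have D: "(f has_real_derivative pi * (1 - h^2) / r * (r^2 + t^2) - h / r^2 * (r^2 + t^2) + 2 * h) (at r)"
    unfolding f_def h_def using r
    by (auto intro!: derivative_eq_intros simp: power2_eq_square field_simps)
  have "pi * (1 - h^2) / r * (r^2 + t^2) - h / r^2 * (r^2 + t^2) + 2 * h = 0"
    by (rule DERIV_local_min[OF D r]) (use min in \<open>auto simp: abs_less_iff\<close>)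
  then have "0 = r^2 * (pi * (1 - h^2) / r * (r^2 + t^2) - h / r^2 * (r^2 + t^2) + 2 * h)" by simp
  also have "\<dots> = pi * r * (1 - h^2) * (r^2 + t^2) - h * (t^2 - r^2)"
    using r by (simp add: power2_eq_square field_simps)
  finally have e: "pi * r * (1 - h^2) * (r^2 + t^2) = h * (t^2 - r^2)" by simp
  have h0: "h > 0" using r by (simp add: h_def)
  \<comment> \<open>Rewriting \<open>1 - h^2\<close> as \<open>1 / cosh^2\<close> and doubling the
    angle turns \<open>pi * r * (1 - h^2)\<close> into \<open>u * h\<close>, after which
    \<open>h\<close> cancels.\<close>
  have "1 - h^2 = ((cosh (pi * r))^2 - (sinh (pi * r))^2) / (cosh (pi * r))^2"
    by (simp add: h_def tanh_def power_divide diff_divide_distrib)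
  then have "1 - h^2 = 1 / (cosh (pi * r))^2" by (simp only: hyperbolic_pythagoras)
  then have g: "pi * r * (1 - h^2) = u * h"
    using sinh_double[of "pi * r"] r by (simp add: u_def h_def tanh_def power2_eq_square mult.assoc)
  have "h * (u * (r^2 + t^2)) = h * (t^2 - r^2)" using e[unfolded g] by (simp add: mult_ac)
  with h0 show "u * (r^2 + (norm1 a / norm0 a)^2) = (norm1 a / norm0 a)^2 - r^2"
    by (simp add: t_def)
qed

text \<open>With \<open>q = exp (- 2 * x)\<close>, the product \<open>(1 - 2 * q) * (1 + q)\<close>
  falls short of \<open>1 - q\<close> by \<open>2 * q^2\<close>.\<close>

lemma one_minus_exp_less_tanh:
  fixes x :: real
  shows "1 - 2 * exp (- 2 * x) < tanh x"
proof -
  have "0 < exp (- 2 * x)" by simp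
  then have "(1 - 2 * exp (- 2 * x)) * (1 + exp (- 2 * x)) < 1 - exp (- 2 * x)"
    by (simp add: algebra_simps)
  then show ?thesis unfolding tanh_real_altdef by (simp add: pos_less_divide_eq add_pos_pos)
qed

text \<open>Common source of the three sharpness claims. The exponential is taken at
  \<open>r\<close> instead of the ratio of the norms, so each claim only has to compare exponentials
  whose arguments are controlled by \<open>\<epsilon>\<close> and \<open>R\<close>.\<close>

lemma ex_near_extremal_norm1:
  fixes \<epsilon> R :: real
  assumes "\<epsilon> > 0"
  shows "\<exists>a r. nonzero_seq a \<and> fin_norm1 a \<and> r \<ge> R \<and> norm1 a / norm0 a < r + \<epsilon> \<and>
    pi * norm0 a * norm1 a * (1 - 2 * exp (- 2 * pi * r)) < (seq_sum a)^2"
proof -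
  have "((\<lambda>r::real. 2 * pi * r / sinh (2 * pi * r)) \<longlongrightarrow> 0) at_top" by real_asymp
  then have 1: "eventually (\<lambda>r::real. 2 * pi * r / sinh (2 * pi * r) < 1) at_top"
    by (rule order_tendstoD) simp
  have "((\<lambda>r::real. 2 * r * (2 * pi * r / sinh (2 * pi * r)) / (1 - (2 * pi * r / sinh (2 * pi * r)))) \<longlongrightarrow> 0) at_top"
    by real_asymp
  then have 2: "eventually (\<lambda>r::real. 2 * r * (2 * pi * r / sinh (2 * pi * r)) / (1 - (2 * pi * r / sinh (2 * pi * r))) < \<epsilon>) at_top"
    by (rule order_tendstoD) (rule assms)
  from eventually_happens'[OF trivial_limit_at_top_linorder eventually_conj[OF 1 eventually_conj[OF 2 eventually_conj[OF eventually_gt_at_top[of 0] eventually_ge_at_top[of R]]]]]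
  obtain r where r: "2 * pi * r / sinh (2 * pi * r) < 1"
    "2 * r * (2 * pi * r / sinh (2 * pi * r)) / (1 - (2 * pi * r / sinh (2 * pi * r))) < \<epsilon>" "r > 0" "r \<ge> R"
    by blast
  define u where "u = 2 * pi * r / sinh (2 * pi * r)"
  have u: "u > 0" "u < 1" "2 * r * u / (1 - u) < \<epsilon>" using r by (auto simp: u_def)
  define a where "a = (\<lambda>k. 1 / ((real k - 1/2)^2 + r^2))"
  note a = inverse_quadratic_seq[OF r(3), folded a_def u_def]
  note n = norms_if_fin_norm1[OF a(1,2)]
  define t where "t = norm1 a / norm0 a"
  \<comment> \<open>The factor \<open>(1 + u) / (1 - u)\<close> is at least 1, so squaring it avoids
    a square root. The resulting excess \<open>2 * r * u / (1 - u)\<close> over \<open>r\<close> is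
    what was made smaller than \<open>\<epsilon>\<close>.\<close>
  have "t^2 = r^2 * ((1 + u) / (1 - u))"
    using a(4) u by (simp add: t_def[symmetric] field_simps)
  also have "\<dots> \<le> r^2 * ((1 + u) / (1 - u))^2"
    using u by (intro mult_left_mono self_le_power) auto
  also have "\<dots> = (r + 2 * r * u / (1 - u))^2"
    using u by (simp add: field_simps flip: power_mult_distrib)
  finally have "t \<le> r + 2 * r * u / (1 - u)"
    by (rule power2_le_imp_le) (use r u in auto)
  with u have t: "norm1 a / norm0 a < r + \<epsilon>" by (simp add: t_def)
  have "pi * norm0 a * norm1 a * (1 - 2 * exp (- 2 * (pi * r))) < pi * norm0 a * norm1 a * tanh (pi * r)"
    using n(3,4) by (intro mult_strict_left_mono one_minus_exp_less_tanh) auto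
  also have "\<dots> \<le> (seq_sum a)^2" using a(3) by (simp add: mult_ac)
  finally show ?thesis using a t r by (intro exI[of _ a] exI[of _ r]) (simp add: mult.assoc)
qed

lemma sharp_leading_constant_norm1:
  fixes C :: real
  assumes "C < pi"
  shows "\<exists>a. nonzero_seq a \<and> fin_norm1 a \<and>
    (seq_sum a)^2 > C * norm0 a * norm1 a * (1 - 2 * exp (- 2 * pi * norm1 a / norm0 a))"
proof -
  \<comment> \<open>\<open>C\<close> may be negative; the monotonicity estimates use a nonnegative
    constant.\<close>
  define D where "D = max C 0"
  have D: "D < pi" "D \<ge> 0" "C \<le> D" using assms by (auto simp: D_def)
  have "((\<lambda>r. pi * (1 - 2 * exp (- 2 * pi * r))) \<longlongrightarrow> pi) at_top" by real_asymp
  then have "eventually (\<lambda>r. D < pi * (1 - 2 * exp (- 2 * pi * r))) at_top"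
    using D(1) by (rule order_tendstoD)
  then obtain R where R: "\<And>r. r \<ge> R \<Longrightarrow> D < pi * (1 - 2 * exp (- 2 * pi * r))"
    by (auto simp: eventually_at_top_linorder)
  obtain a r where a: "nonzero_seq a" "fin_norm1 a" "r \<ge> R"
    "pi * norm0 a * norm1 a * (1 - 2 * exp (- 2 * pi * r)) < (seq_sum a)^2"
    using ex_near_extremal_norm1[of 1 R] zero_less_one by blast
  note n = norms_if_fin_norm1[OF a(1,2)]
  have N: "norm0 a * norm1 a > 0" using n(3,4) by auto
  define q where "q = 1 - 2 * exp (- 2 * pi * norm1 a / norm0 a)"
  \<comment> \<open>Positivity of \<open>q\<close> is read off from the inequality already proved,
    whose left-hand side is a square.\<close>
  have "0 \<le> (seq_sum a)^2" by simp
  also have "\<dots> < pi * (norm0 a * norm1 a) * q"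
    using seq_sum_less_norm1[OF a(1,2)] by (simp add: q_def mult.assoc)
  finally have q: "q > 0" by (rule zero_less_mult_pos) (use N in simp)
  have "C * norm0 a * norm1 a * q \<le> D * (norm0 a * norm1 a) * q"
    using mult_right_mono[OF D(3) less_imp_le[OF mult_pos_pos[OF N q]]] by (simp add: mult.assoc)
  also have "\<dots> \<le> D * (norm0 a * norm1 a) * 1"
    using D N by (intro mult_left_mono) (auto simp: q_def)
  also have "\<dots> \<le> pi * (1 - 2 * exp (- 2 * pi * r)) * (norm0 a * norm1 a)"
    using R[OF a(3)] N by (simp add: mult_right_mono)
  also have "\<dots> < (seq_sum a)^2" using a(4) by (simp add: mult_ac)
  finally show ?thesis using a unfolding q_def by blast
qed

lemma sharp_exp_coefficient_norm1:
  fixes A :: real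
  assumes "A > 2"
  shows "\<exists>a. nonzero_seq a \<and> fin_norm1 a \<and>
    (seq_sum a)^2 > pi * norm0 a * norm1 a * (1 - A * exp (- 2 * pi * norm1 a / norm0 a))"
proof -
  \<comment> \<open>Chosen so that \<open>exp (2 * pi * \<epsilon>) = A / 2\<close>: replacing
    \<open>r\<close> by \<open>r + \<epsilon>\<close> in the exponential costs exactly the factor
    available.\<close>
  define \<epsilon> where "\<epsilon> = ln (A / 2) / (2 * pi)"
  have "\<epsilon> > 0" using assms by (simp add: \<epsilon>_def)
  then obtain a r where a: "nonzero_seq a" "fin_norm1 a" "norm1 a / norm0 a < r + \<epsilon>"
    "pi * norm0 a * norm1 a * (1 - 2 * exp (- 2 * pi * r)) < (seq_sum a)^2"
    using ex_near_extremal_norm1[of \<epsilon> 0] by blast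
  note n = norms_if_fin_norm1[OF a(1,2)]
  have "2 * pi * (norm1 a / norm0 a) \<le> 2 * pi * (r + \<epsilon>)" using a(3) by (intro mult_left_mono) auto
  also have "\<dots> = 2 * pi * r + ln (A / 2)" by (simp add: \<epsilon>_def algebra_simps)
  finally have "exp (- 2 * pi * r) \<le> exp (ln (A / 2) + - 2 * pi * norm1 a / norm0 a)" by simp
  also have "\<dots> = A / 2 * exp (- 2 * pi * norm1 a / norm0 a)" using assms by (simp only: exp_add) simp
  finally have "pi * norm0 a * norm1 a * (1 - A * exp (- 2 * pi * norm1 a / norm0 a))
      \<le> pi * norm0 a * norm1 a * (1 - 2 * exp (- 2 * pi * r))"
    using n(3,4) by (intro mult_left_mono) auto
  with a show ?thesis by (meson le_less_trans)
qed

lemma sharp_exp_rate_norm1: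
  fixes B :: real
  assumes "B < 2 * pi"
  shows "\<exists>a. nonzero_seq a \<and> fin_norm1 a \<and>
    (seq_sum a)^2 > pi * norm0 a * norm1 a * (1 - 2 * exp (- B * norm1 a / norm0 a))"
proof -
  define D where "D = max B 0"
  have D: "D < 2 * pi" "D \<ge> 0" "B \<le> D" using assms by (auto simp: D_def)
  \<comment> \<open>The lower bound on \<open>r\<close> is equivalent to
    \<open>D * (r + 1) \<le> 2 * pi * r\<close>, and \<open>r + 1\<close> exceeds the ratio of the
    norms.\<close>
  obtain a r where a: "nonzero_seq a" "fin_norm1 a" "r \<ge> D / (2 * pi - D)" "norm1 a / norm0 a < r + 1"
    "pi * norm0 a * norm1 a * (1 - 2 * exp (- 2 * pi * r)) < (seq_sum a)^2"
    using ex_near_extremal_norm1[of 1 "D / (2 * pi - D)"] zero_less_one by blast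
  note n = norms_if_fin_norm1[OF a(1,2)]
  have "B * (norm1 a / norm0 a) \<le> D * (norm1 a / norm0 a)" using D n(3,4) by (intro mult_right_mono) auto
  also have "\<dots> \<le> D * (r + 1)" using D a by (intro mult_left_mono) auto
  also have "\<dots> \<le> 2 * pi * r" using a(3) D by (simp add: field_simps)
  finally have "exp (- 2 * pi * r) \<le> exp (- B * norm1 a / norm0 a)" by simp
  then have "pi * norm0 a * norm1 a * (1 - 2 * exp (- B * norm1 a / norm0 a))
      \<le> pi * norm0 a * norm1 a * (1 - 2 * exp (- 2 * pi * r))"
    using n(3,4) by (intro mult_left_mono) auto
  with a show ?thesis by (meson le_less_trans)
qed

section \<open>The second inequality and its extremals\<close>

text \<open>Two estimates are chained, Cauchy-Schwarz and \<open>H \<le> coth (pi / 2)\<close>, and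
  equality must hold in both. The second forces \<open>s = 1/2\<close>, and then the first forces
  proportionality to \<open>1 / w k\<close>.\<close>

lemma seq_sum_le_norm2:
  assumes "nonzero_seq a" "fin_norm2 a" "s > 0"
  shows "(seq_sum a)^2 \<le> pi * coth (pi / 2) / (8 * s^3) * (4 * s^4 * (norm0 a)^2 + (norm2 a)^2)"
    and "(seq_sum a)^2 = pi * coth (pi / 2) / (8 * s^3) * (4 * s^4 * (norm0 a)^2 + (norm2 a)^2) \<longleftrightarrow>
      s = 1/2 \<and> (\<exists>c. \<forall>k\<ge>1. a k = c * extremal_seq k)"
proof -
  note n = norms_if_fin_norm2[OF assms(1,2)]
  define w where "w = (\<lambda>k. (real k + 1/2)^4 + 4 * s^4)"
  define H where "H = (sinh (2 * pi * s) - sin (2 * pi * s)) / (cosh (2 * pi * s) + cos (2 * pi * s))"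
  define Q where "Q = 4 * s^4 * (norm0 a)^2 + (norm2 a)^2"
  have w: "w k > 0" for k using assms(3) by (simp add: w_def add_nonneg_pos)
  have P: "(\<lambda>k. 1 / w k) sums (pi / (8 * s^3) * H)"
    using sums_inverse_quartic[OF assms(3)] by (simp add: w_def H_def)
  have Qs: "(\<lambda>k. w k * (a (Suc k))^2) sums Q"
    using sums_add[OF sums_mult[OF n(1), of "4 * s^4"] n(2)] by (simp add: algebra_simps w_def Q_def)
  have Q0: "Q > 0" using n(4) assms(3) by (simp add: Q_def add_nonneg_pos)
  note CS = weighted_Cauchy_Schwarz_sums[OF w P Qs, folded seq_sum_def]
  have s0: "2 * pi * s > 0" using assms(3) by simp
  have Hle: "H \<le> coth (pi / 2)" and Heq: "H = coth (pi / 2) \<longleftrightarrow> s = 1/2"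
    using quotient_sinh_sin_le_coth[OF s0] by (auto simp: H_def)
  have c: "pi / (8 * s^3) * Q > 0" using Q0 assms(3) by simp
  have le1: "(seq_sum a)^2 \<le> pi / (8 * s^3) * Q * H" using CS(2) by (simp add: mult_ac)
  also have le2: "pi / (8 * s^3) * Q * H \<le> pi / (8 * s^3) * Q * coth (pi / 2)"
    using Hle c by (intro mult_left_mono) auto
  finally show "(seq_sum a)^2 \<le> pi * coth (pi / 2) / (8 * s^3) * (4 * s^4 * (norm0 a)^2 + (norm2 a)^2)"
    by (simp add: Q_def mult_ac)
  have K: "pi * coth (pi / 2) / (8 * s^3) * (4 * s^4 * (norm0 a)^2 + (norm2 a)^2) = pi / (8 * s^3) * Q * coth (pi / 2)"
    by (simp add: Q_def)
  \<comment> \<open>At \<open>s = 1/2\<close> the weight is \<open>(k + 1/2)^4 + 1/4\<close>;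
    multiplying by 16 gives the denominator of \<open>extremal_seq\<close>.\<close>
  have ext: "extremal_seq (Suc k) = 1 / 16 / w k" if "s = 1/2" for k
  proof -
    have "(2 * real (Suc k) - 1)^4 + 4 = (2 * (real k + 1/2))^4 + 4" by (simp add: add_ac)
    also have "\<dots> = 16 * w k" by (simp only: w_def that power_mult_distrib) (simp add: power_divide)
    finally show ?thesis by (simp add: extremal_seq_def)
  qed
  show "(seq_sum a)^2 = pi * coth (pi / 2) / (8 * s^3) * (4 * s^4 * (norm0 a)^2 + (norm2 a)^2) \<longleftrightarrow>
      s = 1/2 \<and> (\<exists>c. \<forall>k\<ge>1. a k = c * extremal_seq k)" (is "?L \<longleftrightarrow> ?R")
  proof
    assume ?L
    then have e: "(seq_sum a)^2 = pi / (8 * s^3) * Q * coth (pi / 2)" by (simp only: K)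
    with le1 le2 have "pi / (8 * s^3) * Q * H = pi / (8 * s^3) * Q * coth (pi / 2)" by linarith
    with c have H: "H = coth (pi / 2)" by (metis less_irrefl mult_left_cancel)
    with Heq have s: "s = 1/2" by simp
    from e H have "(seq_sum a)^2 = pi / (8 * s^3) * H * Q" by (simp only: mult_ac)
    from CS(3)[OF this] obtain d where d: "\<And>k. a (Suc k) = d / w k" by blast
    have "a k = 16 * d * extremal_seq k" if "k \<ge> 1" for k
      using that d ext[OF s] by (cases k) auto
    with s show ?R by blast
  next
    assume ?R
    then obtain c where s: "s = 1/2" and "\<forall>k\<ge>1. a k = c * extremal_seq k" by blast
    then have a: "a (Suc k) = c / 16 * (1 / w k)" for k by (simp add: ext)
    have "(\<lambda>k. a (Suc k)) sums (c / 16 * (pi / (8 * s^3) * H))" unfolding a by (rule sums_mult[OF P])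
    then have S: "seq_sum a = c / 16 * (pi / (8 * s^3) * H)" by (simp add: seq_sum_def sums_iff)
    have "w k * (a (Suc k))^2 = (c / 16)^2 * (1 / w k)" for k
      using w[of k] by (simp only: a power_mult_distrib) (simp add: power2_eq_square)
    then have "(\<lambda>k. (c / 16)^2 * (1 / w k)) sums Q" using Qs by simp
    then have "Q = (c / 16)^2 * (pi / (8 * s^3) * H)" using sums_mult[OF P] by (rule sums_unique2)
    then have "(seq_sum a)^2 = pi / (8 * s^3) * Q * H"
      by (simp only: S power_mult_distrib) (simp add: power2_eq_square)
    moreover have "H = coth (pi / 2)" using s Heq by simp
    ultimately show ?L by (simp only: K)
  qed
qed

text \<open>The minimizer satisfies \<open>s^4 = 3 * N^2 / (4 * M^2)\<close>, where the derivative
  in \<open>x\<close> vanishes. Minimality is part of the conclusion so that the bound can later be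
  compared with the one at \<open>1/2\<close>.\<close>

lemma interpolation_constant_norm2:
  fixes M N K :: real
  assumes M: "M > 0" and N: "N > 0" and K: "K \<ge> 0"
  obtains s where "s > 0"
    "\<And>x. x > 0 \<Longrightarrow> pi * K / (8 * s^3) * (4 * s^4 * M^2 + N^2) \<le> pi * K / (8 * x^3) * (4 * x^4 * M^2 + N^2)"
    "pi * K / (8 * s^3) * (4 * s^4 * M^2 + N^2) =
    sqrt 2 * pi / root 4 27 * K * M powr (3/2) * N powr (1/2)"
proof -
  \<comment> \<open>In terms of \<open>p\<close>, \<open>q\<close> and \<open>d\<close> the
    fractional powers become integer powers.\<close>
  define p where "p = sqrt M"
  define q where "q = sqrt N"
  define d where "d = root 4 (3::real)"
  have pos: "p > 0" "q > 0" "d > 0" using M N by (auto simp: p_def q_def d_def)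
  have d4: "d^4 = 3" by (simp add: d_def)
  have "root 4 27 = root 4 (3^3 :: real)" by simp
  also have "\<dots> = d^3" unfolding d_def by (rule real_root_power) simp
  finally have r27: "root 4 27 = d^3" .
  have M2: "M = p^2" and N2: "N = q^2" using M N by (auto simp: p_def q_def)
  have "p^3 = (M powr (1/2)) powr 3" using M pos by (simp add: p_def powr_half_sqrt)
  then have pw: "M powr (3/2) = p^3" "N powr (1/2) = q"
    using N by (simp_all add: powr_powr q_def powr_half_sqrt)
  define s where "s = d * q / (sqrt 2 * p)"
  have s0: "s > 0" using pos by (simp add: s_def)
  have r2: "sqrt 2 ^ 4 = (4::real)" "sqrt 2 ^ 3 = 2 * sqrt (2::real)"
    by (simp_all add: power4_eq_xxxx power3_eq_cube)
  have "s^4 = 3 * q^4 / (4 * p^4)"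
    by (simp add: s_def power_divide power_mult_distrib d4 r2)
  then have 4: "4 * s^4 * M^2 + N^2 = 4 * q^4"
    using pos by (simp add: M2 N2 flip: power_mult)
  have 3: "s^3 = d^3 * q^3 / (2 * sqrt 2 * p^3)"
    by (simp add: s_def power_divide power_mult_distrib r2)
  have N2s: "N^2 = 4 * s^4 * M^2 / 3" using 4 by (simp add: N2 flip: power_mult)
  have val: "pi * K / (8 * x^3) * (4 * x^4 * M^2 + N^2) = pi * K * M^2 / 6 * ((3 * x^4 + s^4) / x^3)"
    for x
  proof -
    have "4 * x^4 * M^2 + N^2 = 4 * M^2 / 3 * (3 * x^4 + s^4)" by (simp add: N2s algebra_simps)
    then show ?thesis by (simp only:) simp
  qed
  have min: "pi * K / (8 * s^3) * (4 * s^4 * M^2 + N^2) \<le> pi * K / (8 * x^3) * (4 * x^4 * M^2 + N^2)"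
    if "x > 0" for x
  proof -
    \<comment> \<open>Minimality without calculus: \<open>3 * x^4 - 4 * s * x^3 + s^4\<close> has a
      double root at \<open>x = s\<close>.\<close>
    have "0 \<le> (s - x)^2 * (s^2 + 2 * s * x + 3 * x^2)"
      using s0 that by (intro mult_nonneg_nonneg add_nonneg_nonneg) auto
    also have "\<dots> = 3 * x^4 + s^4 - 4 * s * x^3"
      by (simp add: power2_eq_square power3_eq_cube power4_eq_xxxx algebra_simps)
    finally have "4 * s \<le> (3 * x^4 + s^4) / x^3" using that by (simp add: pos_le_divide_eq)
    moreover have "(3 * s^4 + s^4) / s^3 = 4 * s"
      using s0 by (simp add: power3_eq_cube power4_eq_xxxx)
    ultimately show ?thesis unfolding val using K by (intro mult_left_mono) auto
  qed
  have "pi * K / (8 * s^3) * (4 * s^4 * M^2 + N^2) = sqrt 2 * pi / root 4 27 * K * M powr (3/2) * N powr (1/2)"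
    unfolding 4 3 pw r27 using pos by (simp add: field_simps) (simp add: power4_eq_xxxx power3_eq_cube)
  with s0 min show ?thesis by (rule that)
qed

lemma seq_sum_le_interpolation_norm2:
  assumes "nonzero_seq a" "fin_norm2 a"
  defines "R \<equiv> sqrt 2 * pi / root 4 27 * coth (pi / 2) * norm0 a powr (3/2) * norm2 a powr (1/2)"
  shows "(seq_sum a)^2 \<le> R"
    and "(seq_sum a)^2 = R \<longleftrightarrow> (\<exists>c. c \<noteq> 0 \<and> (\<forall>k\<ge>1. a k = c * extremal_seq k))"
proof -
  note n = norms_if_fin_norm2[OF assms(1,2)]
  note S = seq_sum_le_norm2[OF assms(1,2)]
  have "coth (pi / 2) \<ge> 0" by (simp add: coth_def)
  then obtain s where s: "s > 0" "\<And>x. x > 0 \<Longrightarrow> R \<le> pi * coth (pi / 2) / (8 * x^3) * (4 * x^4 * (norm0 a)^2 + (norm2 a)^2)"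
    "pi * coth (pi / 2) / (8 * s^3) * (4 * s^4 * (norm0 a)^2 + (norm2 a)^2) = R"
    unfolding R_def using interpolation_constant_norm2[OF n(3,4)] by metis
  show le: "(seq_sum a)^2 \<le> R" using S(1)[OF s(1)] s(3) by simp
  have nz: "c \<noteq> 0" if "\<forall>k\<ge>1. a k = c * extremal_seq k" for c
    using assms(1) that by (auto simp: nonzero_seq_def)
  show "(seq_sum a)^2 = R \<longleftrightarrow> (\<exists>c. c \<noteq> 0 \<and> (\<forall>k\<ge>1. a k = c * extremal_seq k))"
  proof
    assume "(seq_sum a)^2 = R"
    then show "\<exists>c. c \<noteq> 0 \<and> (\<forall>k\<ge>1. a k = c * extremal_seq k)"
      using S(2)[OF s(1)] s(3) nz by metis
  next
    assume "\<exists>c. c \<noteq> 0 \<and> (\<forall>k\<ge>1. a k = c * extremal_seq k)"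
    \<comment> \<open>For an extremal the bound at \<open>1/2\<close> is attained. Since
      \<open>R\<close> is the least of all these bounds and itself bounds the square of the sum, all
      three agree, with no evaluation of the norms of \<open>extremal_seq\<close>.\<close>
    then have "(seq_sum a)^2 = pi * coth (pi / 2) / (8 * (1/2)^3) * (4 * (1/2)^4 * (norm0 a)^2 + (norm2 a)^2)"
      using S(2)[of "1/2"] by auto
    with s(2)[of "1/2"] le show "(seq_sum a)^2 = R" by simp
  qed
qed
theorem theorem5p1:
  shows "(\<forall>a. nonzero_seq a \<and> fin_norm1 a \<longrightarrow>
           (seq_sum a)^2 < pi * norm0 a * norm1 a * (1 - 2 * exp (- 2 * pi * norm1 a / norm0 a))) \<and>
      (\<forall>C < pi. \<exists>a. nonzero_seq a \<and> fin_norm1 a \<and>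
           (seq_sum a)^2 > C * norm0 a * norm1 a * (1 - 2 * exp (- 2 * pi * norm1 a / norm0 a))) \<and>
      (\<forall>A > 2. \<exists>a. nonzero_seq a \<and> fin_norm1 a \<and>
           (seq_sum a)^2 > pi * norm0 a * norm1 a * (1 - A * exp (- 2 * pi * norm1 a / norm0 a))) \<and>
      (\<forall>B < 2 * pi. \<exists>a. nonzero_seq a \<and> fin_norm1 a \<and>
           (seq_sum a)^2 > pi * norm0 a * norm1 a * (1 - 2 * exp (- B * norm1 a / norm0 a))) \<and>
      (\<forall>a. nonzero_seq a \<and> fin_norm2 a \<longrightarrow>
           (seq_sum a)^2 \<le> sqrt 2 * pi / root 4 27 * coth (pi / 2)
                              * norm0 a powr (3/2) * norm2 a powr (1/2)) \<and>
      (\<forall>a. nonzero_seq a \<and> fin_norm2 a \<longrightarrow>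
           ((seq_sum a)^2 = sqrt 2 * pi / root 4 27 * coth (pi / 2)
                              * norm0 a powr (3/2) * norm2 a powr (1/2)
            \<longleftrightarrow> (\<exists>c. c \<noteq> 0 \<and> (\<forall>k\<ge>1. a k = c * extremal_seq k))))"
proof (intro conjI allI impI; (elim conjE)?)
qed (fact seq_sum_less_norm1 sharp_leading_constant_norm1 sharp_exp_coefficient_norm1
    sharp_exp_rate_norm1 seq_sum_le_interpolation_norm2)+

end
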